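(* Let $\mathfrak{g}$ be a unimodular solvable real Lie algebra with a Vaisman structure $(J,\langle\cdot,\cdot\rangle)$, fundamental $2$-form $\omega$, Lee form $\theta\ne0$, and let $A\in\mathfrak{g}$ be the metric dual of $\theta$, where the metric is normalized so that $|A|=1$. Let $\mathfrak{k}$ be the Kähler flat Lie algebra with underlying vector space $(\operatorname{span}\{A,JA\})^\perp$ associated to $\mathfrak{g}$, let $D=\operatorname{ad}_A|_{\ker\theta}$ and $D'=D|_{\mathfrak{k}}$, so that $\mathfrak{g}=\mathfrak{k}(D,\omega')$ with $\omega'=\omega|_{\mathfrak{k}\times\mathfrak{k}}$. Then the Lie algebra $\mathfrak{d}=\mathbb{R}A\ltimes_{D'}\mathfrak{k}$ admits a coKähler structure $(\langle\cdot,\cdot\rangle|_{\mathfrak{d}\times\mathfrak{d}},\phi,\xi,\eta)$, where $\phi\in\operatorname{End}(\mathfrak{d})$ is defined by $\phi(aA+x)=Jx$ for $a\in\mathbb{R}$, $x\in\mathfrak{k}$, and $\eta:=\theta|_{\mathfrak{d}}$, $\xi:=A$. Moreover, if $\Phi$ denotes the (closed) fundamental $2$-form on $\mathfrak{d}$ associated to this coKähler structure, then $\mathfrak{g}$ is isomorphic to the central extension $\mathfrak{d}_\Phi(JA)$.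
   Context: All Lie algebras are real and finite-dimensional; unimodular means $\operatorname{tr}(\operatorname{ad}_x)=0$ for all $x$. $d$ denotes the Chevalley–Eilenberg differential (so $d\alpha(x,y)=-\alpha([x,y])$ for a $1$-form $\alpha$). A complex structure on a Lie algebra is an endomorphism $J$ with $J^2=-\mathrm{Id}$ and $[Jx,Jy]-[x,y]-J([Jx,y]+[x,Jy])=0$. Given a Hermitian inner product, the fundamental $2$-form is $\omega(x,y)=\langle Jx,y\rangle$. $(J,\langle\cdot,\cdot\rangle)$ is LCK if there is $\theta\in\mathfrak{g}^*$ (the Lee form) with $d\theta=0$ and $d\omega=\theta\wedge\omega$; it is Vaisman if moreover $\nabla\theta=0$, where $\nabla$ is the Levi-Civita connection of $\langle\cdot,\cdot\rangle$ on $\mathfrak{g}$, $\langle\nabla_xy,z\rangle=\frac12(\langle[x,y],z\rangle-\langle[y,z],x\rangle+\langle[z,x],y\rangle)$. Central extension: for a closed $2$-form $\beta$ on a Lie algebra $\mathfrak{h}$, $\mathfrak{h}_\beta(\xi)$ is the vector space $\mathbb{R}\xi\oplus\mathfrak{h}$ with bracket $[x,y]_\beta=\beta(x,y)\xi+[x,y]_{\mathfrak{h}}$ and $\xi$ central. Double extension: $\mathfrak{h}(D,\beta)=\mathbb{R}\ltimes_D\mathfrak{h}_\beta(\xi)$ for a derivation $D$ of $\mathfrak{h}_\beta(\xi)$. Known structure of $\mathfrak{g}$: set $W=(\operatorname{span}\{A,JA\})^\perp$, so $\ker\theta=\mathbb{R}JA\oplus W$. Then $JA$ is central in $\mathfrak{g}$,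 and $[x,y]=\omega(x,y)JA+[x,y]_{\mathfrak{k}}$ for $x,y\in W$, where $[x,y]_{\mathfrak{k}}$ is the $W$-component of $[x,y]$. The Lie algebra $\mathfrak{k}=(W,[\cdot,\cdot]_{\mathfrak{k}})$ with $J|_W$ and $\langle\cdot,\cdot\rangle|_{W\times W}$ is Kähler flat (i.e. $J|_W$ is a complex structure on $\mathfrak k$, its fundamental form $\omega'$ is closed, and the metric has zero curvature); $\ker\theta=\mathfrak{k}_{\omega'}(JA)$, $\mathfrak{g}=\mathfrak{k}(D,\omega')$, and $D'$ is a skew-symmetric derivation of $\mathfrak{k}$ commuting with $J|_W$. As a vector space $\mathfrak{d}=\mathbb{R}A\oplus W\subset\mathfrak{g}$, with bracket $[A,x]=D'x$, $[x,y]=[x,y]_{\mathfrak{k}}$ for $x,y\in W$. An almost contact metric structure on a Lie algebra $\mathfrak{h}$ is $(\langle\cdot,\cdot\rangle,\phi,\xi,\eta)$ with $\langle\cdot,\cdot\rangle$ an inner product, $\phi\in\operatorname{End}(\mathfrak{h})$, $\xi\in\mathfrak{h}$, $\eta\in\mathfrak{h}^*$ such that $\eta(\xi)=1$, $\phi^2=-\mathrm{Id}+\eta\otimes\xi$, $\langle\phi x,\phi y\rangle=\langle x,y\rangle-\eta(x)\eta(y)$. Its fundamental $2$-form is $\Phi(x,y)=\langle\phi x,y\rangle$. It is normal if $N_\phi=-d\eta\otimes\xi$, where $N_\phi(x,y)=[\phi x,\phi y]+\phi^2[x,y]-\phi([\phi x,y]+[x,\phi y])$; it is coKähler if it is normal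 and $d\eta=0$, $d\Phi=0$. *)

theory Defs
  imports "HOL-Analysis.Analysis"
begin

text \<open>
  A real Lie algebra is given by a carrier, which is a linear subspace of an ambient real vector
  space, and a bracket; all conditions only concern the carrier, and values of brackets, maps and
  forms outside it are irrelevant. Finite dimension comes from an ambient type of class
  \<^class>\<open>euclidean_space\<close>, whose inner product \<open>(\<bullet>)\<close> also serves as the metric.
\<close>

definition linear_between :: "'a::real_vector set \<Rightarrow> 'b::real_vector set \<Rightarrow> ('a \<Rightarrow> 'b) \<Rightarrow> bool" where
  "linear_between S T f \<longleftrightarrow>
     f ` S \<subseteq> T \<and> (\<forall>x\<in>S. \<forall>y\<in>S. \<forall>a b. f (a *\<^sub>R x + b *\<^sub>R y) = a *\<^sub>R f x + b *\<^sub>R f y)"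

definition bilinear_between ::
    "'a::real_vector set \<Rightarrow> 'b::real_vector set \<Rightarrow> ('a \<Rightarrow> 'a \<Rightarrow> 'b) \<Rightarrow> bool" where
  "bilinear_between S T f \<longleftrightarrow>
     (\<forall>x\<in>S. linear_between S T (f x)) \<and> (\<forall>y\<in>S. linear_between S T (\<lambda>x. f x y))"

definition lie_algebra_on :: "'a::real_vector set \<Rightarrow> ('a \<Rightarrow> 'a \<Rightarrow> 'a) \<Rightarrow> bool" where
  "lie_algebra_on S br \<longleftrightarrow>
     subspace S \<and> bilinear_between S S br \<and> (\<forall>x\<in>S. br x x = 0) \<and>
     (\<forall>x\<in>S. \<forall>y\<in>S. \<forall>z\<in>S. br x (br y z) + br y (br z x) + br z (br x y) = 0)"

definition lie_isomorphism ::
    "'a::real_vector set \<Rightarrow> ('a \<Rightarrow> 'a \<Rightarrow> 'a) \<Rightarrow> 'b::real_vector set \<Rightarrow> ('b \<Rightarrow> 'b \<Rightarrow> 'b) \<Rightarrow> ('a \<Rightarrow> 'b) \<Rightarrow> bool" where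
  "lie_isomorphism S br T br' f \<longleftrightarrow>
     lie_algebra_on S br \<and> lie_algebra_on T br' \<and> linear_between S T f \<and> bij_betw f S T \<and>
     (\<forall>x\<in>S. \<forall>y\<in>S. f (br x y) = br' (f x) (f y))"

primrec derived_series :: "'a::real_vector set \<Rightarrow> ('a \<Rightarrow> 'a \<Rightarrow> 'a) \<Rightarrow> nat \<Rightarrow> 'a set" where
  "derived_series S br 0 = S"
| "derived_series S br (Suc n) =
     span {br x y |x y. x \<in> derived_series S br n \<and> y \<in> derived_series S br n}"

definition solvable_on :: "'a::real_vector set \<Rightarrow> ('a \<Rightarrow> 'a \<Rightarrow> 'a) \<Rightarrow> bool" where
  "solvable_on S br \<longleftrightarrow> (\<exists>n. derived_series S br n = {0})"

definition linear_trace :: "('a::euclidean_space \<Rightarrow> 'a) \<Rightarrow> real" where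
  "linear_trace f = (\<Sum>b\<in>Basis. f b \<bullet> b)"

definition unimodular :: "('a::euclidean_space \<Rightarrow> 'a \<Rightarrow> 'a) \<Rightarrow> bool" where
  "unimodular br \<longleftrightarrow> (\<forall>x. linear_trace (br x) = 0)"

text \<open>Chevalley--Eilenberg differential on 1-forms and 2-forms, and the wedge product without
  numerical factors.\<close>

definition ce_d1 :: "('a \<Rightarrow> 'a \<Rightarrow> 'a) \<Rightarrow> ('a \<Rightarrow> real) \<Rightarrow> 'a \<Rightarrow> 'a \<Rightarrow> real" where
  "ce_d1 br \<alpha> x y = - \<alpha> (br x y)"

definition ce_d2 :: "('a \<Rightarrow> 'a \<Rightarrow> 'a) \<Rightarrow> ('a \<Rightarrow> 'a \<Rightarrow> real) \<Rightarrow> 'a \<Rightarrow> 'a \<Rightarrow> 'a \<Rightarrow> real" where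
  "ce_d2 br \<omega> x y z = - \<omega> (br x y) z - \<omega> (br y z) x - \<omega> (br z x) y"

definition wedge12 :: "('a \<Rightarrow> real) \<Rightarrow> ('a \<Rightarrow> 'a \<Rightarrow> real) \<Rightarrow> 'a \<Rightarrow> 'a \<Rightarrow> 'a \<Rightarrow> real" where
  "wedge12 \<theta> \<omega> x y z = \<theta> x * \<omega> y z + \<theta> y * \<omega> z x + \<theta> z * \<omega> x y"

definition closed_2form_on ::
    "'a::real_vector set \<Rightarrow> ('a \<Rightarrow> 'a \<Rightarrow> 'a) \<Rightarrow> ('a \<Rightarrow> 'a \<Rightarrow> real) \<Rightarrow> bool" where
  "closed_2form_on S br \<beta> \<longleftrightarrow>
     bilinear_between S UNIV \<beta> \<and> (\<forall>x\<in>S. \<beta> x x = 0) \<and>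
     (\<forall>x\<in>S. \<forall>y\<in>S. \<forall>z\<in>S. ce_d2 br \<beta> x y z = 0)"

definition complex_structure :: "('a::real_vector \<Rightarrow> 'a \<Rightarrow> 'a) \<Rightarrow> ('a \<Rightarrow> 'a) \<Rightarrow> bool" where
  "complex_structure br J \<longleftrightarrow>
     linear J \<and> (\<forall>x. J (J x) = - x) \<and>
     (\<forall>x y. br (J x) (J y) - br x y - J (br (J x) y + br x (J y)) = 0)"

definition hermitian :: "('a::real_inner \<Rightarrow> 'a) \<Rightarrow> bool" where
  "hermitian J \<longleftrightarrow> (\<forall>x y. J x \<bullet> J y = x \<bullet> y)"

definition fundamental_form :: "('a::real_inner \<Rightarrow> 'a) \<Rightarrow> 'a \<Rightarrow> 'a \<Rightarrow> real" where
  "fundamental_form J x y = J x \<bullet> y"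

definition lck :: "('a::euclidean_space \<Rightarrow> 'a \<Rightarrow> 'a) \<Rightarrow> ('a \<Rightarrow> 'a) \<Rightarrow> ('a \<Rightarrow> real) \<Rightarrow> bool" where
  "lck br J \<theta> \<longleftrightarrow>
     complex_structure br J \<and> hermitian J \<and> linear \<theta> \<and> (\<forall>x y. ce_d1 br \<theta> x y = 0) \<and>
     (\<forall>x y z. ce_d2 br (fundamental_form J) x y z = wedge12 \<theta> (fundamental_form J) x y z)"

text \<open>The vector \<open>\<nabla>\<^sub>x y\<close>, assembled from its inner products with an orthonormal basis, which
  are given by the Koszul formula for left-invariant fields.\<close>

definition levi_civita :: "('a::euclidean_space \<Rightarrow> 'a \<Rightarrow> 'a) \<Rightarrow> 'a \<Rightarrow> 'a \<Rightarrow> 'a" where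
  "levi_civita br x y =
     (\<Sum>z\<in>Basis. ((br x y \<bullet> z - br y z \<bullet> x + br z x \<bullet> y) / 2) *\<^sub>R z)"

text \<open>On left-invariant forms, \<open>(\<nabla>\<^sub>x \<theta>)(y) = - \<theta>(\<nabla>\<^sub>x y)\<close>.\<close>

definition vaisman :: "('a::euclidean_space \<Rightarrow> 'a \<Rightarrow> 'a) \<Rightarrow> ('a \<Rightarrow> 'a) \<Rightarrow> ('a \<Rightarrow> real) \<Rightarrow> bool" where
  "vaisman br J \<theta> \<longleftrightarrow> lck br J \<theta> \<and> (\<forall>x y. - \<theta> (levi_civita br x y) = 0)"

text \<open>The central extension \<open>\<hh>\<^sub>\<beta>(\<xi>)\<close> has carrier \<open>UNIV \<times> \<hh>\<close>, the pair \<open>(t, x)\<close> standing for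
  \<open>t \<xi> + x\<close>; the central generator \<open>\<xi>\<close> is \<open>(1, 0)\<close>.\<close>

definition central_ext_carrier :: "'a::real_vector set \<Rightarrow> (real \<times> 'a) set" where
  "central_ext_carrier S = UNIV \<times> S"

definition central_ext_bracket ::
    "('a::real_vector \<Rightarrow> 'a \<Rightarrow> real) \<Rightarrow> ('a \<Rightarrow> 'a \<Rightarrow> 'a) \<Rightarrow> real \<times> 'a \<Rightarrow> real \<times> 'a \<Rightarrow> real \<times> 'a" where
  "central_ext_bracket \<beta> br u v = (\<beta> (snd u) (snd v), br (snd u) (snd v))"

text \<open>Almost contact metric structures \<open>(ip, \<phi>, \<xi>, \<eta>)\<close>.\<close>

definition inner_product_on :: "'a::real_vector set \<Rightarrow> ('a \<Rightarrow> 'a \<Rightarrow> real) \<Rightarrow> bool" where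
  "inner_product_on S ip \<longleftrightarrow>
     bilinear_between S UNIV ip \<and> (\<forall>x\<in>S. \<forall>y\<in>S. ip x y = ip y x) \<and> (\<forall>x\<in>S. x \<noteq> 0 \<longrightarrow> ip x x > 0)"

definition almost_contact_metric ::
    "'a::real_vector set \<Rightarrow> ('a \<Rightarrow> 'a \<Rightarrow> real) \<Rightarrow> ('a \<Rightarrow> 'a) \<Rightarrow> 'a \<Rightarrow> ('a \<Rightarrow> real) \<Rightarrow> bool" where
  "almost_contact_metric S ip \<phi> \<xi> \<eta> \<longleftrightarrow>
     inner_product_on S ip \<and> linear_between S S \<phi> \<and> \<xi> \<in> S \<and> linear_between S UNIV \<eta> \<and>
     \<eta> \<xi> = 1 \<and> (\<forall>x\<in>S. \<phi> (\<phi> x) = - x + \<eta> x *\<^sub>R \<xi>) \<and>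
     (\<forall>x\<in>S. \<forall>y\<in>S. ip (\<phi> x) (\<phi> y) = ip x y - \<eta> x * \<eta> y)"

definition contact_fundamental_form ::
    "('a \<Rightarrow> 'a \<Rightarrow> real) \<Rightarrow> ('a \<Rightarrow> 'a) \<Rightarrow> 'a \<Rightarrow> 'a \<Rightarrow> real" where
  "contact_fundamental_form ip \<phi> x y = ip (\<phi> x) y"

definition nijenhuis_contact ::
    "('a::real_vector \<Rightarrow> 'a \<Rightarrow> 'a) \<Rightarrow> ('a \<Rightarrow> 'a) \<Rightarrow> 'a \<Rightarrow> 'a \<Rightarrow> 'a" where
  "nijenhuis_contact br \<phi> x y =
     br (\<phi> x) (\<phi> y) + \<phi> (\<phi> (br x y)) - \<phi> (br (\<phi> x) y + br x (\<phi> y))"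

definition normal_on ::
    "'a::real_vector set \<Rightarrow> ('a \<Rightarrow> 'a \<Rightarrow> 'a) \<Rightarrow> ('a \<Rightarrow> 'a) \<Rightarrow> 'a \<Rightarrow> ('a \<Rightarrow> real) \<Rightarrow> bool" where
  "normal_on S br \<phi> \<xi> \<eta> \<longleftrightarrow>
     (\<forall>x\<in>S. \<forall>y\<in>S. nijenhuis_contact br \<phi> x y = - (ce_d1 br \<eta> x y *\<^sub>R \<xi>))"

definition coKaehler_on ::
    "'a::real_vector set \<Rightarrow> ('a \<Rightarrow> 'a \<Rightarrow> 'a) \<Rightarrow> ('a \<Rightarrow> 'a \<Rightarrow> real) \<Rightarrow> ('a \<Rightarrow> 'a) \<Rightarrow> 'a \<Rightarrow> ('a \<Rightarrow> real) \<Rightarrow> bool" where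
  "coKaehler_on S br ip \<phi> \<xi> \<eta> \<longleftrightarrow>
     lie_algebra_on S br \<and> almost_contact_metric S ip \<phi> \<xi> \<eta> \<and> normal_on S br \<phi> \<xi> \<eta> \<and>
     (\<forall>x\<in>S. \<forall>y\<in>S. ce_d1 br \<eta> x y = 0) \<and>
     (\<forall>x\<in>S. \<forall>y\<in>S. \<forall>z\<in>S. ce_d2 br (contact_fundamental_form ip \<phi>) x y z = 0)"

definition orth_proj :: "'a::euclidean_space set \<Rightarrow> 'a \<Rightarrow> 'a" where
  "orth_proj S x = (THE y. y \<in> S \<and> x - y \<in> orthogonal_comp S)"

text \<open>The Lie algebra \<open>\<kk>\<close>: its bracket is the \<open>W\<close>-component of the bracket of \<open>\<gg>\<close>, where
  \<open>W\<close> is its underlying vector space.\<close>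

definition kk_carrier :: "('a::euclidean_space \<Rightarrow> 'a) \<Rightarrow> 'a \<Rightarrow> 'a set" where
  "kk_carrier J A = orthogonal_comp (span {A, J A})"

definition kk_bracket ::
    "('a::euclidean_space \<Rightarrow> 'a \<Rightarrow> 'a) \<Rightarrow> ('a \<Rightarrow> 'a) \<Rightarrow> 'a \<Rightarrow> 'a \<Rightarrow> 'a \<Rightarrow> 'a" where
  "kk_bracket br J A x y = orth_proj (kk_carrier J A) (br x y)"

text \<open>The semidirect product \<open>\<real>A \<ltimes>\<^sub>D \<hh>\<close>, realised inside the ambient space for a unit vector
  \<open>A\<close> orthogonal to \<open>\<hh>\<close>: in \<open>u = a A + x\<close> with \<open>x \<in> \<hh>\<close> one then has \<open>a = u \<bullet> A\<close>.\<close>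

definition semidirect_carrier :: "'a::euclidean_space \<Rightarrow> 'a set \<Rightarrow> 'a set" where
  "semidirect_carrier A h = {a *\<^sub>R A + x |a x. x \<in> h}"

definition semidirect_bracket ::
    "'a::euclidean_space \<Rightarrow> ('a \<Rightarrow> 'a) \<Rightarrow> ('a \<Rightarrow> 'a \<Rightarrow> 'a) \<Rightarrow> 'a \<Rightarrow> 'a \<Rightarrow> 'a" where
  "semidirect_bracket A D br u v =
     (let a = u \<bullet> A; x = u - a *\<^sub>R A; b = v \<bullet> A; y = v - b *\<^sub>R A
      in a *\<^sub>R D y - b *\<^sub>R D x + br x y)"

text \<open>The Lie algebra \<open>\<dd> = \<real>A \<ltimes> \<kk>\<close>, where \<open>A\<close> acts on \<open>\<kk>\<close> by the restriction of
  \<open>ad\<^sub>A\<close>, i.e. of \<open>br A\<close>.\<close>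

definition dd_carrier :: "('a::euclidean_space \<Rightarrow> 'a) \<Rightarrow> 'a \<Rightarrow> 'a set" where
  "dd_carrier J A = semidirect_carrier A (kk_carrier J A)"

definition dd_bracket ::
    "('a::euclidean_space \<Rightarrow> 'a \<Rightarrow> 'a) \<Rightarrow> ('a \<Rightarrow> 'a) \<Rightarrow> 'a \<Rightarrow> 'a \<Rightarrow> 'a \<Rightarrow> 'a" where
  "dd_bracket br J A = semidirect_bracket A (br A) (kk_bracket br J A)"

end

theory Submission
  imports Defs
begin

text \<open>
  Put \<open>\<xi> = J A\<close>. Parallelism of \<open>\<theta>\<close>, the LCK equation and the integrability of \<open>J\<close> give
  \<open>[A, \<xi>] = 0\<close>, the skewness of \<open>ad A\<close> and \<open>ad \<xi>\<close>, their commutation with \<open>J\<close>, and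
  \<open>\<langle>[x, y], \<xi>\<rangle> = \<omega>(x, y)\<close> for \<open>x, y \<perp> \<xi>\<close>. Unimodularity forces \<open>\<xi> \<in> [\<gg>, \<gg>]\<close> (unless
  \<open>dim \<gg> = 2\<close>, where \<open>\<gg>\<close> is abelian), and in a solvable Lie algebra an element of \<open>[\<gg>, \<gg>]\<close>
  whose adjoint map is skew is central. So \<open>\<xi>\<close> is central, and \<open>\<dd>\<close> is \<open>\<xi>\<^sup>\<perp>\<close> with the
  projected bracket, a copy of \<open>\<gg> / \<real>\<xi>\<close>; the cocycle of this central extension is the
  \<open>\<xi>\<close>-component \<open>\<Phi>\<close> of the bracket.
\<close>

section \<open>Linear maps on subspaces, traces and transport of Lie algebra structures\<close>

lemma linear_between_UNIV_iff: "linear_between UNIV UNIV f \<longleftrightarrow> linear f"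
proof
  assume f: "linear_between UNIV UNIV f"
  have *: "f (a *\<^sub>R x + b *\<^sub>R y) = a *\<^sub>R f x + b *\<^sub>R f y" for a b x y
    using f by (simp add: linear_between_def)
  show "linear f"
    using *[of 1 _ 1] *[of _ _ 0] by (intro linearI) auto
next
  assume "linear f"
  then show "linear_between UNIV UNIV f"
    by (simp add: linear_between_def linear_add linear_scale)
qed

lemma linear_between_if_linear: "linear f \<Longrightarrow> f ` S \<subseteq> T \<Longrightarrow> linear_between S T f"
  by (simp add: linear_between_def linear_add linear_scale)

lemma bilinear_between_if_bilinear:
  assumes "bilinear f" "\<And>x y. x \<in> S \<Longrightarrow> y \<in> S \<Longrightarrow> f x y \<in> T"
  shows "bilinear_between S T f"
  using assms unfolding bilinear_between_def bilinear_def
  by (auto intro!: linear_between_if_linear)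

lemma linear_between_cong:
  assumes "subspace S" "\<And>x. x \<in> S \<Longrightarrow> f x = g x" "linear_between S T g"
  shows "linear_between S T f"
  using assms unfolding linear_between_def
  by (auto simp: subspace_add subspace_scale image_subset_iff)

lemma bilinear_between_cong:
  assumes "subspace S" "\<And>x y. x \<in> S \<Longrightarrow> y \<in> S \<Longrightarrow> f x y = g x y" "bilinear_between S T g"
  shows "bilinear_between S T f"
  unfolding bilinear_between_def
proof safe
  fix x assume "x \<in> S"
  then show "linear_between S T (f x)" "linear_between S T (\<lambda>y. f y x)"
    using assms by (auto simp: bilinear_between_def intro: linear_between_cong[of S _ "g x"]
        linear_between_cong[of S _ "\<lambda>y. g y x"])
qed

lemma orthonormal_expansion:
  fixes B :: "'a::euclidean_space set"
  assumes "pairwise orthogonal B" "\<And>b. b \<in> B \<Longrightarrow> norm b = 1" "finite B" "x \<in> span B"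
  shows "x = (\<Sum>b\<in>B. (x \<bullet> b) *\<^sub>R b)"
proof -
  let ?y = "x - (\<Sum>b\<in>B. (x \<bullet> b) *\<^sub>R b)"
  have orth: "c \<bullet> b = (if b = c then 1 else 0)" if "b \<in> B" "c \<in> B" for b c
    using assms(1,2) that
    by (auto simp: pairwise_def orthogonal_def dot_square_norm)
  have "orthogonal ?y c" if "c \<in> B" for c
    using that assms(3) by (simp add: orthogonal_def inner_diff_left inner_sum_left orth if_distrib cong: if_cong)
  moreover have "?y \<in> span B"
    using assms(4) by (intro span_diff span_sum span_scale) (auto intro: span_base)
  ultimately have "orthogonal ?y ?y"
    using orthogonal_to_span by blast
  then show ?thesis
    by (simp add: orthogonal_self)
qed

text \<open>As \<open>J\<close> is orthogonal, the vectors \<open>J b\<close> form another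
  orthonormal basis, and the trace does not depend on the basis.\<close>

lemma linear_trace_orthogonal_transformation:
  fixes f J :: "'a::euclidean_space \<Rightarrow> 'a"
  assumes "linear f" "linear J" "\<And>x. J (J x) = - x" "\<And>x y. J x \<bullet> J y = x \<bullet> y"
  shows "(\<Sum>b\<in>Basis. f (J b) \<bullet> J b) = linear_trace f"
proof -
  have skew: "J x \<bullet> y = - (x \<bullet> J y)" for x y
    using assms(4)[of x "J y"] assms(3)[of y] by simp
  have e: "f (J b) \<bullet> J b = (\<Sum>c\<in>Basis. (J b \<bullet> c) * (f c \<bullet> J b))" for b
    by (subst (1) euclidean_representation[of "J b", symmetric])
      (simp add: linear_sum[OF assms(1)] linear_scale[OF assms(1)] inner_sum_left)
  have s: "(\<Sum>b\<in>Basis. (J b \<bullet> c) * (f c \<bullet> J b)) = f c \<bullet> c" for c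
  proof -
    have "(\<Sum>b\<in>Basis. (J b \<bullet> c) * (f c \<bullet> J b)) = f c \<bullet> J (\<Sum>b\<in>Basis. - (J c \<bullet> b) *\<^sub>R b)"
      by (simp add: linear_sum[OF assms(2)] linear_scale[OF assms(2)] linear_neg[OF assms(2)]
          inner_sum_right skew[of _ c] inner_commute[of _ "J c"] sum_negf)
    also have "(\<Sum>b\<in>Basis. - (J c \<bullet> b) *\<^sub>R b) = - J c"
      by (simp add: sum_negf euclidean_representation)
    finally show ?thesis
      by (simp add: linear_neg[OF assms(2)] assms(3))
  qed
  show ?thesis
    unfolding linear_trace_def e by (subst sum.swap) (simp add: s)
qed

text \<open>Transport of structure; it spares a separate check of the Jacobi identity in the central
  extension.\<close>

lemma lie_algebra_on_image:
  assumes lie: "lie_algebra_on UNIV br" and lin: "linear f" and bij: "bij_betw f UNIV T"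
    and hom: "\<And>x y. f (br x y) = br' (f x) (f y)"
  shows "lie_algebra_on T br'"
proof -
  have T: "T = range f"
    using bij by (simp add: bij_betw_def)
  have br: "br (a *\<^sub>R x + b *\<^sub>R y) z = a *\<^sub>R br x z + b *\<^sub>R br y z"
    "br z (a *\<^sub>R x + b *\<^sub>R y) = a *\<^sub>R br z x + b *\<^sub>R br z y" for a b x y z
    using lie by (simp_all add: lie_algebra_on_def bilinear_between_def linear_between_def)
  have f: "f (a *\<^sub>R x + b *\<^sub>R y) = a *\<^sub>R f x + b *\<^sub>R f y" for a b x y
    by (simp add: linear_add[OF lin] linear_scale[OF lin])
  have "br' (f x) (f x) = 0" for x
    using lie by (simp add: hom[symmetric] lie_algebra_on_def linear_0[OF lin])
  moreover have "br' (f x) (br' (f y) (f z)) + br' (f y) (br' (f z) (f x)) + br' (f z) (br' (f x) (f y)) = 0"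
    for x y z
    using lie by (simp add: hom[symmetric] linear_add[OF lin, symmetric] lie_algebra_on_def linear_0[OF lin])
  moreover have "bilinear_between T T br'"
    unfolding T bilinear_between_def linear_between_def
    by (auto simp: hom[symmetric] f[symmetric] br)
  ultimately show ?thesis
    using linear_subspace_image[OF lin subspace_UNIV] by (auto simp: lie_algebra_on_def T)
qed

section \<open>Skew adjoint maps of solvable Lie algebras\<close>

locale euclidean_lie_algebra =
  fixes br :: "'a::euclidean_space \<Rightarrow> 'a \<Rightarrow> 'a"
  assumes lie: "lie_algebra_on UNIV br"
begin

lemma bilinear_br: "bilinear br"
  using lie by (simp add: lie_algebra_on_def bilinear_between_def bilinear_def linear_between_UNIV_iff)

lemma linear_br: "linear (br x)" and linear_br_left: "linear (\<lambda>x. br x y)"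
  using bilinear_br by (simp_all add: bilinear_def)

lemmas br_simps =
  bilinear_ladd[OF bilinear_br] bilinear_radd[OF bilinear_br]
  bilinear_lsub[OF bilinear_br] bilinear_rsub[OF bilinear_br]
  bilinear_lneg[OF bilinear_br] bilinear_rneg[OF bilinear_br]
  bilinear_lmul[OF bilinear_br] bilinear_rmul[OF bilinear_br]
  bilinear_lzero[OF bilinear_br] bilinear_rzero[OF bilinear_br]

lemma br_self [simp]: "br x x = 0"
  using lie by (simp add: lie_algebra_on_def)

lemma br_antisym: "br x y = - br y x"
proof -
  have "br (x + y) (x + y) = br x y + br y x"
    unfolding br_simps by simp
  then show ?thesis by (simp add: eq_neg_iff_add_eq_0)
qed

lemma jacobi: "br x (br y z) + br y (br z x) + br z (br x y) = 0"
  using lie by (simp add: lie_algebra_on_def)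

lemma br_derivation: "br x (br y z) = br (br x y) z + br y (br x z)"
proof -
  have "br y (br z x) = - br y (br x z)" "br z (br x y) = - br (br x y) z"
    using br_antisym[of z x] br_antisym[of z "br x y"] by (simp_all add: br_simps)
  then show ?thesis
    using jacobi[of x y z] by (simp add: algebra_simps add_eq_0_iff)
qed

abbreviation derived :: "nat \<Rightarrow> 'a set" where
  "derived \<equiv> derived_series UNIV br"

lemma subspace_derived: "subspace (derived k)"
  by (cases k) auto

lemma br_derived_Suc: "x \<in> derived k \<Longrightarrow> y \<in> derived k \<Longrightarrow> br x y \<in> derived (Suc k)"
  by (auto intro!: span_base)

text \<open>\<open>br x\<close> is a derivation, so it maps a bracket of two elements of an ideal to
  a sum of two such brackets.\<close>

lemma derived_ideal: "y \<in> derived k \<Longrightarrow> br x y \<in> derived k"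
proof (induction k arbitrary: x y)
  case (Suc k)
  have "y \<in> span {br u v |u v. u \<in> derived k \<and> v \<in> derived k}"
    using Suc.prems by simp
  then show ?case
  proof (induction rule: span_induct_alt)
    case base
    then show ?case by (simp add: br_simps span_zero)
  next
    case (step c y z)
    then obtain u v where "y = br u v" "u \<in> derived k" "v \<in> derived k"
      by blast
    then have "br x y \<in> derived (Suc k)"
      unfolding br_derivation[of x] \<open>y = br u v\<close>
      by (intro subspace_add[OF subspace_derived] br_derived_Suc Suc.IH)
    then show ?case
      unfolding br_simps
      by (intro subspace_add[OF subspace_derived] subspace_scale[OF subspace_derived] step.IH)
  qed
qed simp

lemma derived_decreasing: "derived (Suc k) \<subseteq> derived k"
  unfolding derived_series.simps
  by (rule span_minimal) (auto intro: derived_ideal subspace_derived)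

text \<open>Lie's theorem would give the nilpotency of \<open>ad z\<close> for \<open>z \<in> [\<gg>, \<gg>]\<close>, and a nilpotent
  skew map vanishes. Skewness allows a direct argument: by induction the image of \<open>D = ad z\<close>
  lies in every term \<open>\<aa>\<close> of the derived series. Indeed it then acts trivially on \<open>\<aa> / [\<aa>, \<aa>]\<close>,
  so that \<open>D\<close> commutes there with all \<open>ad x\<close> and the trace of \<open>ad [x, y] \<circ> D\<close> vanishes.
  Hence \<open>D\<^sup>2\<close> has trace \<open>0\<close> on \<open>\<aa> / [\<aa>, \<aa>]\<close>, and \<open>D\<close> vanishes there.\<close>

lemma skew_ad_range_step:
  assumes skew: "\<And>x y. br z x \<bullet> y = - (x \<bullet> br z y)"
    and z: "z \<in> derived 1"
    and range: "\<And>x. br z x \<in> derived k"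
  shows "br z x \<in> derived (Suc k)"
proof -
  let ?a = "derived k" and ?b = "derived (Suc k)"
  \<comment> \<open>\<open>E\<close> stands for the quotient \<open>?a / ?b\<close>; the basis
    \<open>B\<close> chosen below gives coordinates on it.\<close>
  define E where "E = ?a \<inter> orthogonal_comp ?b"
  have "subspace E"
    unfolding E_def by (intro subspace_inter subspace_derived subspace_orthogonal_comp)
  then obtain B where B: "B \<subseteq> E" "pairwise orthogonal B" "\<And>c. c \<in> B \<Longrightarrow> norm c = 1"
    "independent B" "span B = E"
    by (rule orthonormal_basis_subspace) blast
  have fin: "finite B"
    using B(4) by (rule independent_imp_finite)
  have perp: "y \<bullet> c = 0" if "y \<in> ?b" "c \<in> E" for y c
    using that unfolding E_def orthogonal_comp_def orthogonal_def by (auto simp: inner_commute)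
  have decomp: "\<exists>r\<in>?b. y = (\<Sum>c\<in>B. (y \<bullet> c) *\<^sub>R c) + r" if y: "y \<in> ?a" for y
  proof -
    obtain r e where re: "r \<in> span ?b" "\<And>w. w \<in> span ?b \<Longrightarrow> orthogonal e w" "y = r + e"
      using orthogonal_subspace_decomp_exists by blast
    have r: "r \<in> ?b"
      using re(1) span_eq_iff[THEN iffD2, OF subspace_derived] by blast
    then have "e \<in> ?a"
      using re(3) y subspace_diff[OF subspace_derived y, of r] derived_decreasing[of k] by auto
    then have "e \<in> E"
      unfolding E_def orthogonal_comp_def using re(2) by (auto intro: span_base simp: orthogonal_commute)
    then have "e = (\<Sum>c\<in>B. (e \<bullet> c) *\<^sub>R c)"
      using orthonormal_expansion[OF B(2,3) fin] B(5) by blast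
    also have "\<dots> = (\<Sum>c\<in>B. (y \<bullet> c) *\<^sub>R c)"
      using perp[OF r] B(1) by (intro sum.cong) (auto simp: re(3) inner_add_left)
    finally show ?thesis
      using r re(3) by (metis add.commute)
  qed
  have Ea: "c \<in> ?a" if "c \<in> B" for c
    using that B(1) unfolding E_def by blast
  \<comment> \<open>The part of \<open>y\<close> in \<open>?b\<close> does not contribute to
    coefficients along \<open>B\<close>, so these multiply like matrices on the quotient.\<close>
  have coeff: "f y \<bullet> c = (\<Sum>d\<in>B. (y \<bullet> d) * (f d \<bullet> c))"
    if y: "y \<in> ?a" and c: "c \<in> B" and lin: "linear f" and fb: "\<And>w. w \<in> ?b \<Longrightarrow> f w \<in> ?b" for f y c
  proof -
    obtain r where r: "r \<in> ?b" "y = (\<Sum>c\<in>B. (y \<bullet> c) *\<^sub>R c) + r"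
      using decomp[OF y] by blast
    have "f y = (\<Sum>d\<in>B. (y \<bullet> d) *\<^sub>R f d) + f r"
      by (subst r(2)) (simp add: linear_add[OF lin] linear_sum[OF lin] linear_scale[OF lin])
    then show ?thesis
      using perp[OF fb[OF r(1)], of c] c B(1) by (auto simp: inner_add_left inner_sum_left)
  qed
  \<comment> \<open>The trace of \<open>br x\<close> composed with \<open>br z\<close> on
    \<open>?a / ?b\<close>.\<close>
  define T where "T x = (\<Sum>c\<in>B. br x (br z c) \<bullet> c)" for x
  have T_br: "T (br x y) = 0" for x y
  proof -
    have 1: "br x (br y (br z c)) \<bullet> c = (\<Sum>d\<in>B. (br y (br z c) \<bullet> d) * (br x d \<bullet> c))"
      if "c \<in> B" for c
      by (rule coeff[OF _ that]) (intro derived_ideal Ea that linear_br; assumption)+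
    have 2: "br y (br x (br z c)) \<bullet> c = (\<Sum>d\<in>B. (br x c \<bullet> d) * (br y (br z d) \<bullet> c))"
      if c: "c \<in> B" for c
    proof -
      have "br z (br x c) = br (br z x) c + br x (br z c)"
        by (rule br_derivation)
      \<comment> \<open>By \<open>range\<close>, \<open>br z x\<close> lies in \<open>?a\<close>, so
        its bracket with \<open>c\<close> lies in \<open>?b\<close>: modulo \<open>?b\<close>,
        \<open>br z\<close> and \<open>br x\<close> commute on \<open>?a\<close>.\<close>
      moreover have "br y (br (br z x) c) \<bullet> c = 0"
        using c B(1) by (intro perp derived_ideal br_derived_Suc range Ea) auto
      ultimately have "br y (br x (br z c)) \<bullet> c = br y (br z (br x c)) \<bullet> c"
        by (simp add: br_simps inner_add_left)
      also have "\<dots> = (\<Sum>d\<in>B. (br x c \<bullet> d) * (br y (br z d) \<bullet> c))"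
        by (rule coeff[OF _ c, where f = "\<lambda>w. br y (br z w)"])
          (intro derived_ideal Ea c linear_compose[OF linear_br linear_br, unfolded o_def]; assumption)+
      finally show ?thesis .
    qed
    have "T (br x y) = (\<Sum>c\<in>B. br x (br y (br z c)) \<bullet> c) - (\<Sum>c\<in>B. br y (br x (br z c)) \<bullet> c)"
      unfolding T_def sum_subtractf[symmetric]
      by (intro sum.cong) (auto simp: br_derivation[of x y] inner_add_left)
    \<comment> \<open>Cyclicity of the trace.\<close>
    also have "(\<Sum>c\<in>B. br x (br y (br z c)) \<bullet> c) = (\<Sum>c\<in>B. br y (br x (br z c)) \<bullet> c)"
      using 1 2 by simp (subst sum.swap, simp add: mult.commute)
    finally show ?thesis by simp
  qed
  have "z \<in> span {br u v |u v. True}"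
    using z by simp
  then have "T z = 0"
  proof (induction rule: span_induct_alt)
    case base
    then show ?case by (simp add: T_def br_simps)
  next
    case (step c y w)
    then show ?case
      using T_br by (auto simp: T_def br_simps inner_add_left sum.distrib sum_distrib_left[symmetric])
  qed
  moreover have "T z = - (\<Sum>c\<in>B. br z c \<bullet> br z c)"
    by (simp add: T_def skew[of "br z _"] sum_negf)
  ultimately have "\<forall>c\<in>B. br z c \<bullet> br z c = 0"
    using fin by (simp add: sum_nonneg_eq_0_iff)
  then have zero: "br z c = 0" if "c \<in> B" for c
    using that by simp
  obtain r where "r \<in> ?b" "br z x = (\<Sum>c\<in>B. (br z x \<bullet> c) *\<^sub>R c) + r"
    using decomp[OF range] by blast
  moreover have "(\<Sum>c\<in>B. (br z x \<bullet> c) *\<^sub>R c) = 0"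
    by (intro sum.neutral) (simp add: skew zero)
  ultimately show ?thesis by simp
qed

text \<open>The preceding step pushes the image of \<open>br z\<close> down the derived series,
  which reaches 0.\<close>

lemma skew_ad_eq_0:
  assumes "\<And>x y. br z x \<bullet> y = - (x \<bullet> br z y)" "z \<in> derived 1" "solvable_on UNIV br"
  shows "br z x = 0"
proof -
  have "br z x \<in> derived k" for k x
    by (induction k arbitrary: x) (auto intro: skew_ad_range_step[OF assms(1,2)] simp del: derived_series.simps(2))
  then show ?thesis
    using assms(3) unfolding solvable_on_def by blast
qed

end

section \<open>Centrality of \<open>J A\<close>\<close>

locale vaisman_lie_algebra = euclidean_lie_algebra br
  for br :: "'a::euclidean_space \<Rightarrow> 'a \<Rightarrow> 'a" +
  fixes J :: "'a \<Rightarrow> 'a" and A :: 'a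
  assumes vaisman: "vaisman br J (\<lambda>x. A \<bullet> x)" and norm_A: "norm A = 1"
begin

abbreviation "\<xi> \<equiv> J A"

lemma lck: "lck br J (\<lambda>x. A \<bullet> x)"
  using vaisman by (simp add: vaisman_def)

lemma linear_J: "linear J"
  using lck by (simp add: lck_def complex_structure_def)

lemmas J_simps = linear_add[OF linear_J] linear_diff[OF linear_J] linear_neg[OF linear_J]
  linear_scale[OF linear_J] linear_0[OF linear_J]

lemma J_J [simp]: "J (J x) = - x"
  using lck by (simp add: lck_def complex_structure_def)

lemma J_isometry [simp]: "J x \<bullet> J y = x \<bullet> y"
  using lck by (simp add: lck_def hermitian_def)

lemma J_skew: "J x \<bullet> y = - (x \<bullet> J y)"
  using J_isometry[of x "J y"] by simp

lemma inner_A_J: "A \<bullet> J x = - (\<xi> \<bullet> x)" "J x \<bullet> A = - (\<xi> \<bullet> x)"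
  using J_skew[of A x] by (simp_all add: inner_commute)

lemma inner_A_A [simp]: "A \<bullet> A = 1"
  using norm_A by (simp add: dot_square_norm)

lemma inner_J_self [simp]: "x \<bullet> J x = 0" "J x \<bullet> x = 0"
  using J_skew[of x x] inner_commute[of x "J x"] by simp_all

lemma nijenhuis: "br (J x) (J y) - br x y = J (br (J x) y + br x (J y))"
  using lck by (simp add: lck_def complex_structure_def)

lemma inner_br_A [simp]: "br x y \<bullet> A = 0" "A \<bullet> br x y = 0"
  using lck by (simp_all add: lck_def ce_d1_def inner_commute)

lemma d_omega:
  "- (J (br x y) \<bullet> z) - J (br y z) \<bullet> x - J (br z x) \<bullet> y =
    (A \<bullet> x) * (J y \<bullet> z) + (A \<bullet> y) * (J z \<bullet> x) + (A \<bullet> z) * (J x \<bullet> y)"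
  using lck by (simp add: lck_def ce_d2_def fundamental_form_def wedge12_def)

text \<open>The Koszul expression is linear in its third argument, so \<theta> applied to the
  connection is its value at \<open>A\<close>. There \<langle>[x, y], A\<rangle> vanishes because
  \<theta> is closed, and parallelism says that \<open>br A\<close> is skew.\<close>

lemma ad_A_skew: "br A x \<bullet> y = - (x \<bullet> br A y)"
proof -
  let ?k = "\<lambda>z. (br x y \<bullet> z - br y z \<bullet> x + br z x \<bullet> y) / 2"
  have "linear ?k"
    by (rule linearI) (auto simp: br_simps inner_add_left inner_add_right algebra_simps add_divide_distrib diff_divide_distrib)
  have "?k A = ?k (\<Sum>b\<in>Basis. (A \<bullet> b) *\<^sub>R b)"
    by (simp add: euclidean_representation)
  also have "\<dots> = (\<Sum>b\<in>Basis. (A \<bullet> b) * ?k b)"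
    unfolding linear_sum[OF \<open>linear ?k\<close>] linear_scale[OF \<open>linear ?k\<close>] by simp
  also have "\<dots> = A \<bullet> levi_civita br x y"
    by (simp add: levi_civita_def inner_sum_right mult.commute)
  also have "\<dots> = 0"
    using vaisman by (simp add: vaisman_def)
  finally show ?thesis
    using br_antisym[of y A] by (simp add: inner_commute)
qed

lemma inner_br_xi_d_omega:
  "br x y \<bullet> \<xi> + br A x \<bullet> J y - br A y \<bullet> J x =
    J x \<bullet> y - (A \<bullet> x) * (\<xi> \<bullet> y) + (A \<bullet> y) * (\<xi> \<bullet> x)"
proof -
  have "J (br x y) \<bullet> A = - (br x y \<bullet> \<xi>)" "J (br A x) \<bullet> y = - (br A x \<bullet> J y)"
    "J (br y A) \<bullet> x = br A y \<bullet> J x"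
    using br_antisym[of y A] by (simp_all add: J_skew[of "br _ _"] J_simps)
  then show ?thesis
    using d_omega[of x y A] by (simp add: inner_A_J)
qed

text \<open>Integrability at \<open>A\<close>, \<open>w\<close> and the LCK equation at \<xi>,
  \<open>J w\<close>, \<open>A\<close> give \<langle>[\<xi>, J w], \<xi>\<rangle> as
  \<langle>[A, \<xi>], w\<rangle> with opposite signs.\<close>

lemma br_A_xi [simp]: "br A \<xi> = 0" "br \<xi> A = 0"
proof -
  have "br A \<xi> \<bullet> w = 0" for w
  proof -
    have "br \<xi> (J w) \<bullet> \<xi> - br A w \<bullet> \<xi> = J (br \<xi> w + br A (J w)) \<bullet> \<xi>"
      unfolding nijenhuis[of A w, symmetric] by (simp add: inner_diff_left)
    then have "br \<xi> (J w) \<bullet> \<xi> = - (br A \<xi> \<bullet> w)"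
      using ad_A_skew[of w \<xi>] by (simp add: inner_add_left inner_commute[of w "br A \<xi>"])
    moreover have "br \<xi> (J w) \<bullet> \<xi> = br A \<xi> \<bullet> w"
      using inner_br_xi_d_omega[of \<xi> "J w"] by (simp add: inner_A_J)
    ultimately show ?thesis by simp
  qed
  from this[of "br A \<xi>"] show "br A \<xi> = 0" by simp
  then show "br \<xi> A = 0" using br_antisym[of \<xi> A] by simp
qed

text \<open>Brackets are orthogonal to \<open>A\<close>, so their images under \<open>J\<close> are
  orthogonal to \<xi>.\<close>

lemma inner_br_J_J_xi: "br (J x) (J y) \<bullet> \<xi> = br x y \<bullet> \<xi>"
  using arg_cong[OF nijenhuis[of x y], of "\<lambda>v. v \<bullet> \<xi>"]
  by (simp add: inner_diff_left inner_add_left)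

text \<open>The map \<open>ad\<^sub>A \<circ> J - J \<circ> ad\<^sub>A\<close> anticommutes with \<open>J\<close>, whereas all other terms of
  \<open>inner_br_xi_d_omega\<close> are \<open>J\<close>-invariant.\<close>

lemma ad_A_J: "br A (J x) = J (br A x)"
proof -
  define Q where "Q x = br A (J x) - J (br A x)" for x
  have QJ: "Q (J x) = - J (Q x)" for x
    by (simp add: Q_def br_simps J_simps)
  have E: "br x y \<bullet> \<xi> + Q x \<bullet> y = J x \<bullet> y - (A \<bullet> x) * (\<xi> \<bullet> y) + (A \<bullet> y) * (\<xi> \<bullet> x)" for x y
    using inner_br_xi_d_omega[of x y] ad_A_skew[of y "J x"]
    by (simp add: Q_def inner_diff_left J_skew[of "br A x"] inner_commute[of y])
  have "Q x \<bullet> y = 0" for x y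
    using E[of "J x" "J y"] E[of x y]
    by (simp add: QJ inner_br_J_J_xi inner_A_J mult.commute J_skew[of x y])
  from this[of x "Q x"] show ?thesis
    by (simp add: Q_def)
qed

text \<open>In the integrability identity at \<open>A\<close>, \<open>x\<close> the two terms with
  \<open>br A\<close> cancel by \<open>ad_A_J\<close>.\<close>

lemma ad_xi_J: "br \<xi> (J x) = J (br \<xi> x)"
  using nijenhuis[of A x] by (simp add: J_simps ad_A_J)

text \<open>Since \<open>br A\<close> is skew and commutes with \<open>J\<close>, its two terms in
  \<open>inner_br_xi_d_omega\<close> cancel.\<close>

lemma inner_br_xi: "br x y \<bullet> \<xi> = J x \<bullet> y - (A \<bullet> x) * (\<xi> \<bullet> y) + (A \<bullet> y) * (\<xi> \<bullet> x)"
  using inner_br_xi_d_omega[of x y] ad_A_skew[of y "J x"]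
  by (simp add: ad_A_J J_skew[of "br A x"] inner_commute[of y])

text \<open>The LCK equation with third argument \<xi> makes \<open>J\<close> composed with
  \<open>br \<xi>\<close> symmetric; the factors commute, so \<open>br \<xi>\<close> is
  skew.\<close>

lemma ad_xi_skew: "br \<xi> x \<bullet> y = - (x \<bullet> br \<xi> y)"
proof -
  have "J (br \<xi> y) \<bullet> x = J (br \<xi> x) \<bullet> y" for x y
    using d_omega[of x y \<xi>] br_antisym[of y \<xi>] by (simp add: J_simps inner_A_J inner_commute[of _ \<xi>])
  from this[of "J y" x] show ?thesis
    by (simp add: ad_xi_J J_simps inner_commute[of x])
qed

text \<open>The trace of the orthogonal projection onto the complement of \<open>A\<close> and
  \<xi>.\<close>

lemma sum_W_norms:
  "(\<Sum>b\<in>Basis. (norm (b - (A \<bullet> b) *\<^sub>R A - (\<xi> \<bullet> b) *\<^sub>R \<xi>))\<^sup>2) = real DIM('a) - 2"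
proof -
  have *: "(norm (b - (A \<bullet> b) *\<^sub>R A - (\<xi> \<bullet> b) *\<^sub>R \<xi>))\<^sup>2 = 1 - (A \<bullet> b) * (A \<bullet> b) - (\<xi> \<bullet> b) * (\<xi> \<bullet> b)"
    if "b \<in> Basis" for b
    using that by (simp add: power2_norm_eq_inner inner_diff_left inner_diff_right inner_commute algebra_simps)
  show ?thesis
    using euclidean_inner[of A A] euclidean_inner[of \<xi> \<xi>]
    by (simp add: * sum_subtractf)
qed

text \<open>If not, then some \<open>a \<perp> [\<gg>, \<gg>]\<close> has \<open>a \<bullet> \<xi> = 1\<close>, and \<open>\<xi> - a\<close> is dual to a primitive of
  \<open>d\<xi>\<^sup>\<flat>\<close> on \<open>\<langle>A\<rangle>\<^sup>\<perp>\<close>. Contracting with \<open>v = - J (\<xi> - a)\<close> gives a vector whose adjoint map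
  scales the transverse symplectic form, so that its trace does not vanish.\<close>

lemma xi_in_commutator:
  assumes unimod: "unimodular br" and dim: "DIM('a) \<noteq> 2"
  shows "\<xi> \<in> span {br x y |x y. True}"
proof (rule ccontr)
  let ?S = "{br x y |x y. True}"
  assume notin: "\<xi> \<notin> span ?S"
  obtain s e where se: "s \<in> span ?S" "\<And>w. w \<in> span ?S \<Longrightarrow> orthogonal e w" "\<xi> = s + e"
    using orthogonal_subspace_decomp_exists by blast
  have "e \<noteq> 0"
    using se notin by auto
  have "e \<bullet> \<xi> = e \<bullet> e"
    using se(2)[OF se(1)] unfolding se(3) by (simp add: orthogonal_def inner_add_right)
  \<comment> \<open>Scaling gives \<open>a0 \<bullet> \<xi> = 1\<close>. Removing the component
    along \<open>A\<close> keeps this and keeps \<open>a\<close> orthogonal to all brackets, as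
    \<open>A\<close> is.\<close>
  define a0 where "a0 = e /\<^sub>R (e \<bullet> e)"
  define a where "a = a0 - (a0 \<bullet> A) *\<^sub>R A"
  have "e \<bullet> br x y = 0" for x y
    using se(2)[of "br x y"] by (auto intro: span_base simp: orthogonal_def)
  then have a: "br x y \<bullet> a = 0" for x y
    by (simp add: a_def a0_def inner_diff_right inner_commute)
  have a_xi: "\<xi> \<bullet> a = 1"
    using \<open>e \<bullet> \<xi> = e \<bullet> e\<close> \<open>e \<noteq> 0\<close> by (simp add: a_def a0_def inner_diff_right inner_commute)
  have a_A: "A \<bullet> a = 0"
    by (simp add: a_def inner_diff_right inner_commute)
  \<comment> \<open>Against brackets \<open>w\<close> pairs like \<xi>, but it is orthogonal to
    \<open>A\<close> and \<xi>. The choice of \<open>v\<close> makes \<omega>(v, x) = \<langle>w,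
    x\<rangle>.\<close>
  define w where "w = \<xi> - a"
  define v where "v = - J w"
  have Jv: "J v = w"
    by (simp add: v_def J_simps)
  have w: "A \<bullet> w = 0" "\<xi> \<bullet> w = 0" "A \<bullet> v = 0"
    by (simp_all add: v_def inner_A_J) (simp_all add: w_def inner_diff_right a_xi a_A)
  have pair: "br v x \<bullet> x + br v (J x) \<bullet> J x =
      x \<bullet> x - (A \<bullet> x) * (A \<bullet> x) - (\<xi> \<bullet> x) * (\<xi> \<bullet> x) + (A \<bullet> x) * (v \<bullet> x) + (\<xi> \<bullet> x) * (w \<bullet> x)" for x
  proof -
    have "br x (J x) \<bullet> w = br x (J x) \<bullet> \<xi>"
      by (simp add: w_def inner_diff_right a)
    also have "\<dots> = x \<bullet> x - (A \<bullet> x) * (A \<bullet> x) - (\<xi> \<bullet> x) * (\<xi> \<bullet> x)"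
      by (simp add: inner_br_xi inner_A_J)
    moreover have "J (br x (J x)) \<bullet> v = - (br x (J x) \<bullet> w)"
      by (simp add: J_skew[of "br _ _"] Jv)
    moreover have "J (br (J x) v) \<bullet> x = br v (J x) \<bullet> J x"
      using br_antisym[of "J x" v] by (simp add: J_skew[of "br _ _"] J_simps)
    ultimately show ?thesis
      using d_omega[of v x "J x"] by (simp add: inner_A_J Jv w inner_commute[of x v])
  qed
  \<comment> \<open>Doubling the trace pairs \<open>b\<close> with \<open>J b\<close>. As
    \<open>A \<bullet> v\<close> and \<open>\<xi> \<bullet> w\<close> vanish, the sum is the
    dimension minus 2.\<close>
  have "2 * linear_trace (br v) = (\<Sum>b\<in>Basis. br v b \<bullet> b + br v (J b) \<bullet> J b)"
    using linear_trace_orthogonal_transformation[OF linear_br linear_J J_J J_isometry, of v]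
    by (simp add: sum.distrib linear_trace_def)
  also have "\<dots> = real DIM('a) - A \<bullet> A - \<xi> \<bullet> \<xi> + A \<bullet> v + \<xi> \<bullet> w"
    unfolding pair euclidean_inner[of A A] euclidean_inner[of \<xi> \<xi>]
      euclidean_inner[of A v] euclidean_inner[of \<xi> w]
    by (simp add: sum.distrib sum_subtractf)
  finally show False
    using unimod dim w by (simp add: unimodular_def)
qed

lemma xi_central:
  assumes "unimodular br" "solvable_on UNIV br"
  shows "br \<xi> x = 0"
proof (cases "DIM('a) = 2")
  case True
  \<comment> \<open>A vanishing sum of squares: every basis vector is a combination of
    \<open>A\<close> and \<xi>, and \<xi> commutes with both.\<close>
  then have "\<forall>b\<in>Basis. b - (A \<bullet> b) *\<^sub>R A - (\<xi> \<bullet> b) *\<^sub>R \<xi> = 0"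
    using sum_W_norms by (simp add: sum_nonneg_eq_0_iff)
  then have "b = (A \<bullet> b) *\<^sub>R A + (\<xi> \<bullet> b) *\<^sub>R \<xi>" if "b \<in> Basis" for b
    using that by (metis add.commute diff_eq_eq diff_zero eq_iff_diff_eq_0)
  then have "br \<xi> b = br \<xi> ((A \<bullet> b) *\<^sub>R A + (\<xi> \<bullet> b) *\<^sub>R \<xi>)" if "b \<in> Basis" for b
    using that by metis
  then have "br \<xi> b = 0" if "b \<in> Basis" for b
    using that by (simp add: br_simps)
  then show ?thesis
    using linear_eq_stdbasis[OF linear_br linear_zero, of \<xi>] by (simp add: fun_eq_iff)
next
  case False
  then show ?thesis
    using xi_in_commutator assms by (intro skew_ad_eq_0 ad_xi_skew) auto
qed

end

section \<open>The coKaehler quotient\<close>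

locale vaisman_lie_algebra_central = vaisman_lie_algebra br J A
  for br :: "'a::euclidean_space \<Rightarrow> 'a \<Rightarrow> 'a" and J A +
  assumes br_xi_left [simp]: "br \<xi> x = 0"
begin

lemma br_xi_right [simp]: "br x \<xi> = 0"
  using br_antisym[of x \<xi>] by simp

text \<open>Models the quotient map by the central line of \<xi>, with the hyperplane orthogonal to
  \<xi> as representatives.\<close>

definition pr :: "'a \<Rightarrow> 'a" where
  "pr x = x - (x \<bullet> \<xi>) *\<^sub>R \<xi>"

lemma linear_pr: "linear pr"
  by (rule linearI) (simp_all add: pr_def inner_add_left algebra_simps)

lemma inner_pr [simp]: "pr x \<bullet> \<xi> = 0" "pr x \<bullet> A = x \<bullet> A" "A \<bullet> pr x = A \<bullet> x"
  by (simp_all add: pr_def inner_diff_left inner_diff_right)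

lemma pr_id: "x \<bullet> \<xi> = 0 \<Longrightarrow> pr x = x"
  by (simp add: pr_def)

lemma br_pr [simp]: "br x (pr y) = br x y" "br (pr x) y = br x y"
  by (simp_all add: pr_def br_simps)

lemma J_pr: "J (pr x) = J x + (x \<bullet> \<xi>) *\<^sub>R A"
  by (simp add: pr_def J_simps)

lemma mem_kk_iff: "x \<in> kk_carrier J A \<longleftrightarrow> x \<bullet> A = 0 \<and> x \<bullet> \<xi> = 0"
proof
  assume "x \<in> kk_carrier J A"
  then show "x \<bullet> A = 0 \<and> x \<bullet> \<xi> = 0"
    by (auto simp: kk_carrier_def orthogonal_comp_def orthogonal_def inner_commute[of x] intro: span_base)
next
  assume x: "x \<bullet> A = 0 \<and> x \<bullet> \<xi> = 0"
  have "orthogonal x y" if "y \<in> span {A, \<xi>}" for y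
    by (rule orthogonal_to_span[OF that]) (use x in \<open>auto simp: orthogonal_def\<close>)
  then show "x \<in> kk_carrier J A"
    by (auto simp: kk_carrier_def orthogonal_comp_def orthogonal_commute)
qed

text \<open>Brackets are already orthogonal to \<open>A\<close>, so only the \<xi>-component has to
  be removed.\<close>

lemma kk_bracket_eq: "kk_bracket br J A x y = pr (br x y)"
  unfolding kk_bracket_def orth_proj_def
proof (rule the_equality)
  show "pr (br x y) \<in> kk_carrier J A \<and> br x y - pr (br x y) \<in> orthogonal_comp (kk_carrier J A)"
    by (auto simp: mem_kk_iff pr_def inner_diff_left orthogonal_comp_def orthogonal_def)
next
  fix z assume z: "z \<in> kk_carrier J A \<and> br x y - z \<in> orthogonal_comp (kk_carrier J A)"
  let ?d = "pr (br x y) - z"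
  have d: "?d \<in> kk_carrier J A"
    using z by (simp add: mem_kk_iff inner_diff_left)
  then have "?d \<bullet> (br x y - z) = 0" "?d \<bullet> \<xi> = 0"
    using z by (auto simp: orthogonal_comp_def orthogonal_def mem_kk_iff)
  moreover have "?d = (br x y - z) - (br x y \<bullet> \<xi>) *\<^sub>R \<xi>"
    by (simp add: pr_def)
  ultimately have "?d \<bullet> ?d = 0"
    by (metis inner_diff_right inner_scaleR_right mult_zero_right diff_zero)
  then show "z = pr (br x y)" by simp
qed

lemma mem_dd_iff: "u \<in> dd_carrier J A \<longleftrightarrow> u \<bullet> \<xi> = 0"
proof
  assume "u \<bullet> \<xi> = 0"
  then have "u - (u \<bullet> A) *\<^sub>R A \<in> kk_carrier J A"
    by (simp add: mem_kk_iff inner_diff_left)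
  then show "u \<in> dd_carrier J A"
    unfolding dd_carrier_def semidirect_carrier_def by force
qed (auto simp: dd_carrier_def semidirect_carrier_def mem_kk_iff inner_add_left)

lemma subspace_dd: "subspace (dd_carrier J A)"
  by (rule subspaceI) (simp_all add: mem_dd_iff inner_add_left)

lemma inner_br_A_xi: "br A x \<bullet> \<xi> = 0"
  by (simp add: ad_A_skew)

text \<open>Values of \<open>br A\<close> have no \<xi>-component, so projecting the whole bracket
  agrees with projecting only its part on the kernel of \<theta>.\<close>

lemma dd_bracket_eq:
  assumes "u \<in> dd_carrier J A" "v \<in> dd_carrier J A"
  shows "dd_bracket br J A u v = pr (br u v)"
  using br_antisym[of u A]
  by (simp add: dd_bracket_def semidirect_bracket_def Let_def kk_bracket_eq pr_def br_simps
      inner_diff_left inner_diff_right inner_br_A_xi algebra_simps)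

lemma dd_bracket_in: "u \<in> dd_carrier J A \<Longrightarrow> v \<in> dd_carrier J A \<Longrightarrow> dd_bracket br J A u v \<in> dd_carrier J A"
  by (simp add: dd_bracket_eq) (simp add: mem_dd_iff)

lemma bilinear_pr_br: "bilinear (\<lambda>u v. pr (br u v))"
  unfolding bilinear_def
  by (auto intro!: linear_compose[OF linear_br linear_pr, unfolded o_def]
      linear_compose[OF linear_br_left linear_pr, unfolded o_def])

text \<open>Centrality of \<xi> makes inner projections invisible to brackets, so the Jacobi sum is
  the projection of the one in \<open>br\<close>.\<close>

lemma lie_algebra_dd: "lie_algebra_on (dd_carrier J A) (dd_bracket br J A)"
  unfolding lie_algebra_on_def
proof (intro conjI ballI subspace_dd)
  show "bilinear_between (dd_carrier J A) (dd_carrier J A) (dd_bracket br J A)"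
    by (rule bilinear_between_cong[OF subspace_dd dd_bracket_eq])
      (auto intro!: bilinear_between_if_bilinear bilinear_pr_br simp: mem_dd_iff)
next
  fix x assume "x \<in> dd_carrier J A"
  then show "dd_bracket br J A x x = 0"
    by (simp add: dd_bracket_eq pr_def)
next
  fix x y z assume "x \<in> dd_carrier J A" "y \<in> dd_carrier J A" "z \<in> dd_carrier J A"
  then show "dd_bracket br J A x (dd_bracket br J A y z) + dd_bracket br J A y (dd_bracket br J A z x) +
      dd_bracket br J A z (dd_bracket br J A x y) = 0"
    using jacobi[of x y z]
    by (simp add: dd_bracket_eq[OF _ dd_bracket_in] linear_add[OF linear_pr, symmetric])
      (simp add: dd_bracket_eq linear_0[OF linear_pr])
qed

section \<open>The coKaehler structure defined by \<open>\<phi>\<close> and the central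
  extension\<close>

context
  fixes \<phi> :: "'a \<Rightarrow> 'a"
  assumes \<phi>: "\<And>a x. x \<in> kk_carrier J A \<Longrightarrow> \<phi> (a *\<^sub>R A + x) = J x"
begin

abbreviation "\<Phi> \<equiv> contact_fundamental_form (\<bullet>) \<phi>"

lemma phi_eq: "u \<in> dd_carrier J A \<Longrightarrow> \<phi> u = J u - (u \<bullet> A) *\<^sub>R \<xi>"
  using \<phi>[of "u - (u \<bullet> A) *\<^sub>R A" "u \<bullet> A"]
  by (simp add: mem_kk_iff mem_dd_iff inner_diff_left J_simps)

lemma phi_in: "u \<in> dd_carrier J A \<Longrightarrow> \<phi> u \<in> dd_carrier J A"
  by (simp add: phi_eq) (simp add: mem_dd_iff inner_diff_left)

lemma Phi_eq: "u \<in> dd_carrier J A \<Longrightarrow> v \<in> dd_carrier J A \<Longrightarrow> \<Phi> u v = J u \<bullet> v"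
  by (simp add: contact_fundamental_form_def phi_eq inner_diff_left)
    (simp add: mem_dd_iff inner_commute)

lemma inner_br_xi_dd: "u \<in> dd_carrier J A \<Longrightarrow> v \<in> dd_carrier J A \<Longrightarrow> br u v \<bullet> \<xi> = J u \<bullet> v"
  by (simp add: inner_br_xi mem_dd_iff inner_commute[of \<xi>])

lemma almost_contact_metric_dd:
  "almost_contact_metric (dd_carrier J A) (\<bullet>) \<phi> A (\<lambda>x. A \<bullet> x)"
  unfolding almost_contact_metric_def
proof (intro conjI ballI)
  show "inner_product_on (dd_carrier J A) (\<bullet>)"
    unfolding inner_product_on_def
    by (auto intro!: bilinear_between_if_bilinear bounded_bilinear_inner
        simp: inner_commute bilinear_conv_bounded_bilinear)
  show "linear_between (dd_carrier J A) (dd_carrier J A) \<phi>"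
    by (rule linear_between_cong[OF subspace_dd phi_eq])
      (auto intro!: linear_between_if_linear linearI
        simp: J_simps inner_add_left algebra_simps mem_dd_iff inner_diff_left)
  show "A \<in> dd_carrier J A" "A \<bullet> A = 1"
    by (simp_all add: mem_dd_iff)
  show "linear_between (dd_carrier J A) UNIV (\<lambda>x. A \<bullet> x)"
    by (auto intro!: linear_between_if_linear linearI simp: inner_add_right)
next
  fix x assume x: "x \<in> dd_carrier J A"
  then show "\<phi> (\<phi> x) = - x + (A \<bullet> x) *\<^sub>R A"
    by (simp add: phi_eq[OF phi_in])
      (simp add: phi_eq, simp add: mem_dd_iff J_simps inner_diff_left inner_A_J inner_commute[of x])
next
  fix x y assume "x \<in> dd_carrier J A" "y \<in> dd_carrier J A"
  then show "\<phi> x \<bullet> \<phi> y = x \<bullet> y - (A \<bullet> x) * (A \<bullet> y)"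
    by (simp add: phi_eq inner_diff_left inner_diff_right) (simp add: inner_commute)
qed

lemma normal_dd: "normal_on (dd_carrier J A) (dd_bracket br J A) \<phi> A (\<lambda>x. A \<bullet> x)"
  unfolding normal_on_def
proof (intro ballI)
  fix u v assume u: "u \<in> dd_carrier J A" and v: "v \<in> dd_carrier J A"
  \<comment> \<open>\<open>\<phi> u\<close> and \<open>J u\<close> differ by a multiple of the
    central \<xi>.\<close>
  have pu: "br (\<phi> u) w = br (J u) w" "br w (\<phi> u) = br w (J u)" if "u \<in> dd_carrier J A" for u w
    using that by (simp_all add: phi_eq br_simps)
  have phi_phi: "\<phi> (\<phi> (pr (br u v))) = - pr (br u v)"
  proof -
    have "\<forall>x\<in>dd_carrier J A. \<phi> (\<phi> x) = - x + (A \<bullet> x) *\<^sub>R A"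
      using almost_contact_metric_dd unfolding almost_contact_metric_def by blast
    then show ?thesis
      by (simp add: mem_dd_iff inner_commute[of A])
  qed
  let ?z = "br (J u) v + br u (J v)"
  have "\<xi> \<bullet> u = 0" "\<xi> \<bullet> v = 0"
    using u v by (simp_all add: mem_dd_iff inner_commute[of \<xi>])
  \<comment> \<open>With no component along \<xi> or \<open>A\<close>, \<open>?z\<close> is mapped
    by \<open>\<phi>\<close> as by \<open>J\<close>, and normality becomes the integrability of
    \<open>J\<close> modulo \<xi>.\<close>
  then have "?z \<bullet> \<xi> = 0"
    by (simp add: inner_add_left inner_br_xi inner_A_J mult.commute)
  moreover have "?z \<bullet> A = 0"
    by (simp add: inner_add_left)
  ultimately have "\<phi> (pr ?z) = J ?z"
    by (simp add: phi_eq mem_dd_iff pr_id)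
  moreover have "pr (br (J u) (J v)) - pr (br u v) = J ?z"
    unfolding nijenhuis[symmetric] by (simp add: pr_def inner_br_J_J_xi)
  ultimately have "nijenhuis_contact (dd_bracket br J A) \<phi> u v = 0"
    using u v unfolding nijenhuis_contact_def
    by (simp add: dd_bracket_eq phi_in pu phi_phi linear_add[OF linear_pr, symmetric])
  then show "nijenhuis_contact (dd_bracket br J A) \<phi> u v =
      - (ce_d1 (dd_bracket br J A) (\<lambda>x. A \<bullet> x) u v *\<^sub>R A)"
    using u v by (simp add: ce_d1_def dd_bracket_eq)
qed

text \<open>Dropping the \<xi>-component of the bracket adds \<omega>(u, v) \<theta>(w); the cyclic
  sum of these terms is \<theta> \<and> \<omega> and cancels the right side of the LCK
  equation.\<close>

lemma d_Phi_dd: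
  assumes "x \<in> dd_carrier J A" "y \<in> dd_carrier J A" "z \<in> dd_carrier J A"
  shows "ce_d2 (dd_bracket br J A) \<Phi> x y z = 0"
proof -
  have "\<Phi> (dd_bracket br J A u v) w = J (br u v) \<bullet> w + (J u \<bullet> v) * (A \<bullet> w)"
    if "u \<in> dd_carrier J A" "v \<in> dd_carrier J A" "w \<in> dd_carrier J A" for u v w
    using that by (simp add: Phi_eq dd_bracket_in)
      (simp add: dd_bracket_eq J_pr inner_add_left inner_br_xi_dd)
  then show ?thesis
    using d_omega[of x y z] assms by (simp add: ce_d2_def mult.commute)
qed

lemma coKaehler_dd:
  "coKaehler_on (dd_carrier J A) (dd_bracket br J A) (\<bullet>) \<phi> A (\<lambda>x. A \<bullet> x)"
  unfolding coKaehler_on_def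
  using lie_algebra_dd almost_contact_metric_dd normal_dd d_Phi_dd
  by (simp add: ce_d1_def dd_bracket_eq)

lemma closed_Phi_dd: "closed_2form_on (dd_carrier J A) (dd_bracket br J A) \<Phi>"
  unfolding closed_2form_on_def
proof (intro conjI ballI d_Phi_dd)
  show "bilinear_between (dd_carrier J A) UNIV \<Phi>"
    by (rule bilinear_between_cong[OF subspace_dd Phi_eq])
      (auto intro!: bilinear_between_if_bilinear linearI
        simp: bilinear_def J_simps inner_add_left inner_add_right)
qed (auto simp: Phi_eq)

text \<open>Split \<open>x\<close> into its \<xi>-component and \<open>pr x\<close>. By centrality a
  bracket depends only on the projections, and its \<xi>-component is \<Phi> of them.\<close>

lemma central_extension_isomorphism:
  "lie_isomorphism UNIV br (central_ext_carrier (dd_carrier J A))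
     (central_ext_bracket \<Phi> (dd_bracket br J A)) (\<lambda>x. (x \<bullet> \<xi>, pr x))"
  unfolding lie_isomorphism_def
proof (intro conjI ballI)
  let ?C = "central_ext_carrier (dd_carrier J A)" and ?f = "\<lambda>x. (x \<bullet> \<xi>, pr x)"
  let ?b = "central_ext_bracket \<Phi> (dd_bracket br J A)"
  have lin: "linear ?f"
    by (rule linearI) (simp_all add: inner_add_left linear_add[OF linear_pr] linear_scale[OF linear_pr])
  have f_in: "?f x \<in> ?C" for x
    by (simp add: central_ext_carrier_def mem_dd_iff)
  show "linear_between UNIV ?C ?f"
    using lin f_in by (auto intro: linear_between_if_linear)
  show bij: "bij_betw ?f UNIV ?C"
    by (rule bij_betw_byWitness[where f' = "\<lambda>(t, x). t *\<^sub>R \<xi> + x"])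
      (auto simp: central_ext_carrier_def mem_dd_iff pr_def inner_add_left inner_diff_left)
  have hom: "?f (br x y) = ?b (?f x) (?f y)" for x y
    using inner_br_xi_dd[of "pr x" "pr y"] Phi_eq[of "pr x" "pr y"]
    by (simp add: central_ext_bracket_def dd_bracket_eq mem_dd_iff)
  then show "?f (br x y) = ?b (?f x) (?f y)" for x y .
  show "lie_algebra_on UNIV br" by (rule lie)
  show "lie_algebra_on ?C ?b"
    by (rule lie_algebra_on_image[OF lie lin bij]) (rule hom)
qed

lemma central_extension:
  "\<exists>f. lie_isomorphism UNIV br (central_ext_carrier (dd_carrier J A))
      (central_ext_bracket \<Phi> (dd_bracket br J A)) f \<and> f \<xi> = (1, 0)"
  using central_extension_isomorphism by (intro exI[of _ "\<lambda>x. (x \<bullet> \<xi>, pr x)"]) (simp add: pr_def)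

end

end

theorem theorem7p1:
  fixes br :: "'a::euclidean_space \<Rightarrow> 'a \<Rightarrow> 'a"
    and J \<phi> :: "'a \<Rightarrow> 'a" and \<theta> :: "'a \<Rightarrow> real" and A :: 'a
  assumes "lie_algebra_on UNIV br"
    and "unimodular br"
    and "solvable_on UNIV br"
    and "vaisman br J \<theta>"
    and "\<theta> \<noteq> (\<lambda>_. 0)"
    and "\<And>x. \<theta> x = A \<bullet> x"
    and "norm A = 1"
    and "\<And>a x. x \<in> kk_carrier J A \<Longrightarrow> \<phi> (a *\<^sub>R A + x) = J x"
  shows "coKaehler_on (dd_carrier J A) (dd_bracket br J A) (\<bullet>) \<phi> A \<theta> \<and>
    closed_2form_on (dd_carrier J A) (dd_bracket br J A) (contact_fundamental_form (\<bullet>) \<phi>) \<and>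
    (\<exists>f. lie_isomorphism UNIV br (central_ext_carrier (dd_carrier J A))
           (central_ext_bracket (contact_fundamental_form (\<bullet>) \<phi>) (dd_bracket br J A)) f \<and>
         f (J A) = (1, 0))"
proof -
  have \<theta>: "\<theta> = (\<lambda>x. A \<bullet> x)"
    using assms(6) by blast
  interpret vaisman_lie_algebra br J A
    using assms(1,4,7) by unfold_locales (simp_all add: \<theta>)
  interpret vaisman_lie_algebra_central br J A
    by unfold_locales (rule xi_central[OF assms(2,3)])
  show ?thesis
    using coKaehler_dd[OF assms(8)] closed_Phi_dd[OF assms(8)] central_extension[OF assms(8)]
    by (simp add: \<theta>)
qed

end
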